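(* Let $S$ be a semigroup with a proper involution $\iota$. Then there are internal semidirect product decompositions $$\operatorname{Aut}^{\pm}(S)=\operatorname{Aut}(S)\rtimes\langle\iota\rangle\qquad\text{and}\qquad \mathscr C(S)=(\mathscr C(S)\cap\operatorname{Aut}(S))\rtimes\langle\iota\rangle .$$ That is, $\operatorname{Aut}^{\pm}(S)$ (respectively, $\mathscr C(S)$) is a split extension with quotient $\mathbb Z_2$ and kernel $\operatorname{Aut}(S)$ (respectively, $\mathscr C(S)\cap\operatorname{Aut}(S)$).
   Context: For a semigroup $S$: $\operatorname{Aut}(S)$ is the set of automorphisms of $S$; $\operatorname{Aut}^-(S)$ is the set of anti-automorphisms, i.e. bijections $\alpha:S\to S$ with $\alpha(xy)=\alpha(y)\alpha(x)$ for all $x,y\in S$; and $\operatorname{Aut}^{\pm}(S)=\operatorname{Aut}(S)\cup\operatorname{Aut}^-(S)$, a group under composition. An involution of $S$ is an anti-automorphism $\alpha$ with $\alpha^2=\mathrm{id}_S\neq\alpha$; it is proper if it is not also a homomorphism. $I(S)$ is the set of all involutions of $S$, and $\mathscr C(S)=\langle I(S)\rangle$ is the subgroup of $\operatorname{Aut}^{\pm}(S)$ generated by $I(S)$. Internal semidirect product $A=N\rtimes H$ means $N$ is a normal subgroup of $A$, $H$ is a subgroup, $A=NH$ and $N\cap H$ is trivial. *)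

theory Defs
  imports "HOL-Algebra.Elementary_Groups" "HOL-Algebra.Bij"
begin

text \<open>
  A semigroup is carried by the record type of HOL-Algebra monoids, so that the library's
  \<^const>\<open>hom\<close> and \<^const>\<open>auto\<close> apply to it. The field \<^const>\<open>one\<close> of the record is arbitrary
  and plays no role.
\<close>

locale carrier_semigroup =
  fixes S (structure)
  assumes m_closed: "\<lbrakk>x \<in> carrier S; y \<in> carrier S\<rbrakk> \<Longrightarrow> x \<otimes> y \<in> carrier S"
    and m_assoc: "\<lbrakk>x \<in> carrier S; y \<in> carrier S; z \<in> carrier S\<rbrakk>
      \<Longrightarrow> (x \<otimes> y) \<otimes> z = x \<otimes> (y \<otimes> z)"

text \<open>
  As in \<^const>\<open>auto\<close>, maps on the carrier are represented by extensional functions; the identity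
  of \<open>S\<close> is thus \<open>\<lambda>x\<in>carrier S. x\<close> and composition is \<open>compose (carrier S)\<close>, which are the unit
  and the multiplication of \<^const>\<open>BijGroup\<close>.
\<close>

definition anti_auto :: "('a, 'b) monoid_scheme \<Rightarrow> ('a \<Rightarrow> 'a) set"
  where "anti_auto S = {\<alpha> \<in> Bij (carrier S).
    \<forall>x\<in>carrier S. \<forall>y\<in>carrier S. \<alpha> (x \<otimes>\<^bsub>S\<^esub> y) = \<alpha> y \<otimes>\<^bsub>S\<^esub> \<alpha> x}"

definition AutPMGroup :: "('a, 'b) monoid_scheme \<Rightarrow> ('a \<Rightarrow> 'a) monoid"
  where "AutPMGroup S = BijGroup (carrier S) \<lparr>carrier := auto S \<union> anti_auto S\<rparr>"

definition involutions :: "('a, 'b) monoid_scheme \<Rightarrow> ('a \<Rightarrow> 'a) set"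
  where "involutions S = {\<alpha> \<in> anti_auto S.
    compose (carrier S) \<alpha> \<alpha> = (\<lambda>x\<in>carrier S. x) \<and> \<alpha> \<noteq> (\<lambda>x\<in>carrier S. x)}"

definition proper_involution :: "('a, 'b) monoid_scheme \<Rightarrow> ('a \<Rightarrow> 'a) \<Rightarrow> bool"
  where "proper_involution S \<alpha> \<longleftrightarrow> \<alpha> \<in> involutions S \<and> \<alpha> \<notin> hom S S"

definition involution_closure :: "('a, 'b) monoid_scheme \<Rightarrow> ('a \<Rightarrow> 'a) set"
  where "involution_closure S = generate (AutPMGroup S) (involutions S)"

definition InvolutionGroup :: "('a, 'b) monoid_scheme \<Rightarrow> ('a \<Rightarrow> 'a) monoid"
  where "InvolutionGroup S = AutPMGroup S \<lparr>carrier := involution_closure S\<rparr>"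

definition internal_semidirect ::
    "('g, 'm) monoid_scheme \<Rightarrow> 'g set \<Rightarrow> 'g set \<Rightarrow> bool"
  where "internal_semidirect A N H \<longleftrightarrow>
    N \<lhd> A \<and> subgroup H A \<and> carrier A = N <#>\<^bsub>A\<^esub> H \<and> N \<inter> H = {\<one>\<^bsub>A\<^esub>}"

text \<open>
  \<open>A\<close> is a split extension with kernel \<open>N\<close> and quotient \<open>Q\<close>. The library's
  \<open>short_exact_sequence\<close> requires all groups to have elements of the same type, which is too
  restrictive for \<open>Q = integer_mod_group 2\<close>.
\<close>

definition split_extension ::
    "('g, 'm) monoid_scheme \<Rightarrow> 'g set \<Rightarrow> ('q, 'n) monoid_scheme \<Rightarrow> bool"
  where "split_extension A N Q \<longleftrightarrow> group A \<and> group Q \<and>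
    (\<exists>p \<in> epi A Q. kernel A Q p = N \<and>
      (\<exists>s \<in> hom Q A. \<forall>q\<in>carrier Q. p (s q) = q))"

end

theory Submission
  imports Defs
begin

text \<open>
  Since \<open>\<iota>\<close> is proper, it lies outside \<open>Aut(S)\<close>, while \<open>\<alpha>\<iota>\<close>, as a product of two
  anti-automorphisms, lies in \<open>Aut(S)\<close> for every anti-automorphism \<open>\<alpha>\<close>. Thus \<open>Aut(S)\<close> has index
  \<open>2\<close> and is complemented by \<open>{1, \<iota>}\<close>; intersecting with a subgroup containing \<open>\<iota>\<close> preserves this.
\<close>

section \<open>Subgroups of index two complemented by an involution\<close>

text \<open>Abstracts the situation shared by both groups of the theorem. Since \<open>t\<close> is
  its own inverse, \<open>mult_t_mem\<close> puts every element outside \<open>N\<close> into the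
  coset of \<open>t\<close>, so \<open>N\<close> has index two.\<close>

locale involution_complement = group G + subgroup N G for G (structure) and N +
  fixes t
  assumes t_carrier: "t \<in> carrier G"
    and t_notin: "t \<notin> N"
    and t_square: "t \<otimes> t = \<one>"
    and mult_t_mem: "\<lbrakk>x \<in> carrier G; x \<notin> N\<rbrakk> \<Longrightarrow> x \<otimes> t \<in> N"
begin

lemma mult_mem_left_iff: "\<lbrakk>x \<in> N; y \<in> carrier G\<rbrakk> \<Longrightarrow> x \<otimes> y \<in> N \<longleftrightarrow> y \<in> N"
  by (metis inv_solve_left m_closed m_inv_closed mem_carrier)

lemma mult_mem_right_iff: "\<lbrakk>x \<in> carrier G; y \<in> N\<rbrakk> \<Longrightarrow> x \<otimes> y \<in> N \<longleftrightarrow> x \<in> N"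
  by (metis inv_solve_right m_closed m_inv_closed mem_carrier)

text \<open>Membership in \<open>N\<close> behaves like a parity. This one fact yields both
  normality of \<open>N\<close> and the homomorphism onto the group of order two. If both factors
  lie outside \<open>N\<close>, inserting \<open>t \<otimes> t = \<one>\<close> between them splits
  the product into two elements of \<open>N\<close>.\<close>

lemma mult_mem_iff:
  assumes x: "x \<in> carrier G" and y: "y \<in> carrier G"
  shows "x \<otimes> y \<in> N \<longleftrightarrow> (x \<in> N \<longleftrightarrow> y \<in> N)"
proof (cases "x \<in> N \<or> y \<in> N")
  case True
  then show ?thesis
    using assms mult_mem_left_iff mult_mem_right_iff by blast
next
  case False
  \<comment> \<open>\<open>mult_t_mem\<close> multiplies by \<open>t\<close> on the right only;
    passing to inverses gives \<open>t \<otimes> y \<in> N\<close>.\<close>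
  have "inv y \<otimes> t \<in> N"
    using False y mult_t_mem[of "inv y"] m_inv_closed[of "inv y"] by auto
  then have "inv (inv y \<otimes> t) \<in> N"
    by (rule m_inv_closed)
  moreover have "inv (inv y \<otimes> t) = t \<otimes> y"
    using y t_carrier t_square by (simp add: inv_mult_group inv_equality)
  ultimately have "(x \<otimes> t) \<otimes> (t \<otimes> y) \<in> N"
    using False x mult_t_mem m_closed by simp
  moreover have "(x \<otimes> t) \<otimes> (t \<otimes> y) = x \<otimes> y"
  proof -
    have "(x \<otimes> t) \<otimes> (t \<otimes> y) = x \<otimes> ((t \<otimes> t) \<otimes> y)"
      using x y t_carrier by (simp add: m_assoc)
    then show ?thesis
      using x y t_square by simp
  qed
  ultimately show ?thesis
    using False by simp
qed

lemma generate_involution: "generate G {t} = {\<one>, t}"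
proof
  have "inv t = t"
    using t_carrier t_square by (simp add: inv_equality)
  then have "subgroup {\<one>, t} G"
    using t_carrier t_square by unfold_locales auto
  then show "generate G {t} \<subseteq> {\<one>, t}"
    by (intro generate_subgroup_incl) auto
  show "{\<one>, t} \<subseteq> generate G {t}"
    by (auto intro: generate.intros)
qed

theorem internal_semidirect: "internal_semidirect G N (generate G {t})"
  unfolding internal_semidirect_def
proof (intro conjI)
  \<comment> \<open>The product of \<open>x\<close> and \<open>inv x\<close> is
    \<open>\<one>\<close>, which lies in \<open>N\<close>, so both have the same parity and they
    cancel around \<open>h\<close>.\<close>
  have "x \<otimes> h \<otimes> inv x \<in> N" if "x \<in> carrier G" "h \<in> N" for x h
    using that mult_mem_iff[of x "inv x"] by (simp add: mult_mem_iff)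
  then show "N \<lhd> G"
    using subgroup_axioms by (simp add: normal_inv_iff)
  show "subgroup (generate G {t}) G"
    using t_carrier by (simp add: generate_is_subgroup)
  have "\<exists>n\<in>N. \<exists>h\<in>{\<one>, t}. x = n \<otimes> h" if "x \<in> carrier G" for x
  proof (cases "x \<in> N")
    case True
    then show ?thesis
      using that by (intro bexI[of _ x] bexI[of _ \<one>]) auto
  next
    case False
    \<comment> \<open>The factorization is \<open>x = (x \<otimes> t) \<otimes> t\<close>.\<close>
    then show ?thesis
      using that t_carrier t_square
      by (intro bexI[of _ "x \<otimes> t"] bexI[of _ t]) (auto simp: m_assoc mult_t_mem)
  qed
  then show "carrier G = N <#> generate G {t}"
    using t_carrier unfolding generate_involution set_mult_def by auto
  show "N \<inter> generate G {t} = {\<one>}"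
    using t_notin by (auto simp: generate_involution)
qed

theorem split_extension: "split_extension G N (integer_mod_group 2)"
proof -
  \<comment> \<open>\<open>p\<close> is the parity with respect to \<open>N\<close>, and
    \<open>s\<close> sends the generator of the quotient to \<open>t\<close>; it is a homomorphism
    because \<open>t\<close> squares to \<open>\<one>\<close>. Surjectivity of \<open>p\<close> then
    follows from \<open>p (s q) = q\<close>.\<close>
  define p where "p x = (if x \<in> N then 0 else 1 :: int)" for x
  define s where "s q = (if q = 0 then \<one> else t)" for q :: int
  have carrier_Z2: "carrier (integer_mod_group 2) = {0, 1}"
    by (auto simp: carrier_integer_mod_group)
  have p_s: "p (s q) = q" if "q \<in> carrier (integer_mod_group 2)" for q
    using that t_notin by (auto simp: p_def s_def carrier_Z2)
  have s: "s \<in> hom (integer_mod_group 2) G"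
    using t_carrier t_square by (auto simp: hom_def s_def carrier_Z2)
  have "p \<in> hom G (integer_mod_group 2)"
    by (auto simp: hom_def p_def carrier_Z2 mult_mem_iff)
  moreover have "p ` carrier G = carrier (integer_mod_group 2)"
  proof
    show "p ` carrier G \<subseteq> carrier (integer_mod_group 2)"
      by (auto simp: p_def carrier_Z2)
    show "carrier (integer_mod_group 2) \<subseteq> p ` carrier G"
      using p_s s by (metis hom_carrier image_eqI image_subset_iff subsetI)
  qed
  moreover have "kernel G (integer_mod_group 2) p = N"
    by (auto simp: kernel_def p_def split: if_splits)
  ultimately show ?thesis
    unfolding split_extension_def epi_def using p_s s is_group by auto
qed

text \<open>Right multiplication by \<open>t\<close> keeps \<open>K\<close> stable because
  \<open>t \<in> K\<close>, so the index-two condition passes to \<open>K\<close>.\<close>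

lemma restrict_subgroup:
  assumes K: "subgroup K G" and t: "t \<in> K"
  shows "involution_complement (G\<lparr>carrier := K\<rparr>) (K \<inter> N) t"
proof -
  have "subgroup (K \<inter> N) (G\<lparr>carrier := K\<rparr>)"
    by (intro subgroup_incl subgroups_Inter_pair K subgroup_axioms) simp
  moreover have "group (G\<lparr>carrier := K\<rparr>)"
    using K is_group by (rule subgroup.subgroup_is_group)
  ultimately show ?thesis
    unfolding involution_complement_def involution_complement_axioms_def
    using t t_notin t_square mult_t_mem subgroup.m_closed[OF K] subgroup.mem_carrier[OF K] by simp
qed

end

section \<open>Automorphisms and anti-automorphisms of a semigroup\<close>

context carrier_semigroup
begin

text \<open>Bijectivity already gives the closure condition in \<open>hom\<close>, so
  \<open>auto\<close> takes the same shape as \<open>anti_auto\<close> and both can be unfolded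
  alike.\<close>

lemma auto_iff:
  "f \<in> auto S \<longleftrightarrow> f \<in> Bij (carrier S) \<and>
    (\<forall>x\<in>carrier S. \<forall>y\<in>carrier S. f (x \<otimes> y) = f x \<otimes> f y)"
  by (auto simp: auto_def hom_def dest: Bij_imp_funcset)

lemma anti_auto_iff:
  "f \<in> anti_auto S \<longleftrightarrow> f \<in> Bij (carrier S) \<and>
    (\<forall>x\<in>carrier S. \<forall>y\<in>carrier S. f (x \<otimes> y) = f y \<otimes> f x)"
  by (simp add: anti_auto_def)

lemma compose_auto_auto:
  "\<lbrakk>f \<in> auto S; g \<in> auto S\<rbrakk> \<Longrightarrow> compose (carrier S) f g \<in> auto S"
  by (auto simp: auto_iff compose_Bij compose_eq m_closed
      funcset_mem[OF Bij_imp_funcset])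

lemma compose_auto_anti_auto:
  "\<lbrakk>f \<in> auto S; g \<in> anti_auto S\<rbrakk> \<Longrightarrow> compose (carrier S) f g \<in> anti_auto S"
  by (auto simp: auto_iff anti_auto_iff compose_Bij compose_eq m_closed
      funcset_mem[OF Bij_imp_funcset])

lemma compose_anti_auto_auto:
  "\<lbrakk>f \<in> anti_auto S; g \<in> auto S\<rbrakk> \<Longrightarrow> compose (carrier S) f g \<in> anti_auto S"
  by (auto simp: auto_iff anti_auto_iff compose_Bij compose_eq m_closed
      funcset_mem[OF Bij_imp_funcset])

text \<open>Reversing the order of factors twice restores it. This supplies
  \<open>mult_t_mem\<close> for \<iota>.\<close>

lemma compose_anti_auto_anti_auto:
  "\<lbrakk>f \<in> anti_auto S; g \<in> anti_auto S\<rbrakk> \<Longrightarrow> compose (carrier S) f g \<in> auto S"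
  by (auto simp: auto_iff anti_auto_iff compose_Bij compose_eq m_closed
      funcset_mem[OF Bij_imp_funcset])

lemma inv_auto:
  assumes "f \<in> auto S"
  shows "restrict (inv_into (carrier S) f) (carrier S) \<in> auto S"
  using assms m_closed
  by (simp add: auto_iff restrict_inv_into_Bij Bij_inv_into_lemma Pi_def)

lemma inv_anti_auto:
  assumes f: "f \<in> anti_auto S"
  shows "restrict (inv_into (carrier S) f) (carrier S) \<in> anti_auto S"
proof -
  have bij: "bij_betw f (carrier S) (carrier S)"
    using f by (simp add: anti_auto_iff Bij_def)
  have "inv_into (carrier S) f (x \<otimes> y) = inv_into (carrier S) f y \<otimes> inv_into (carrier S) f x"
    if x: "x \<in> carrier S" and y: "y \<in> carrier S" for x y
  proof -
    \<comment> \<open>In terms of preimages, the claim reduces to \<open>f\<close> reversing the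
      product \<open>v \<otimes> u\<close>.\<close>
    obtain u v where uv: "u \<in> carrier S" "v \<in> carrier S" "x = f u" "y = f v"
      using bij x y by (metis bij_betw_imp_surj_on imageE)
    then have "x \<otimes> y = f (v \<otimes> u)"
      using f by (simp add: anti_auto_iff)
    then show ?thesis
      using uv bij m_closed by (simp add: bij_betw_inv_into_left)
  qed
  then show ?thesis
    using f m_closed by (simp add: anti_auto_iff restrict_inv_into_Bij)
qed

lemma auto_union_anti_auto_subset: "auto S \<union> anti_auto S \<subseteq> Bij (carrier S)"
  by (auto simp: auto_iff anti_auto_iff)

lemma id_in_auto: "(\<lambda>x\<in>carrier S. x) \<in> auto S"
  by (simp add: auto_iff id_Bij m_closed)

lemma subgroup_auto_BijGroup: "subgroup (auto S) (BijGroup (carrier S))"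
proof (rule subgroup.intro)
  fix f g
  assume "f \<in> auto S" "g \<in> auto S"
  then show "f \<otimes>\<^bsub>BijGroup (carrier S)\<^esub> g \<in> auto S"
    using compose_auto_auto by (simp add: BijGroup_def auto_iff)
next
  fix f
  assume f: "f \<in> auto S"
  then have "inv\<^bsub>BijGroup (carrier S)\<^esub> f = restrict (inv_into (carrier S) f) (carrier S)"
    by (simp add: inv_BijGroup auto_iff)
  then show "inv\<^bsub>BijGroup (carrier S)\<^esub> f \<in> auto S"
    using f by (simp only: inv_auto)
qed (use auto_union_anti_auto_subset id_in_auto in \<open>auto simp: BijGroup_def\<close>)

lemma subgroup_auto_union_anti_auto:
  "subgroup (auto S \<union> anti_auto S) (BijGroup (carrier S))"
proof (rule subgroup.intro)
  fix f g
  assume "f \<in> auto S \<union> anti_auto S" "g \<in> auto S \<union> anti_auto S"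
  then show "f \<otimes>\<^bsub>BijGroup (carrier S)\<^esub> g \<in> auto S \<union> anti_auto S"
    using auto_union_anti_auto_subset
    by (auto simp: BijGroup_def subset_iff compose_auto_auto compose_auto_anti_auto
        compose_anti_auto_auto compose_anti_auto_anti_auto)
next
  fix f
  assume f: "f \<in> auto S \<union> anti_auto S"
  then have "inv\<^bsub>BijGroup (carrier S)\<^esub> f = restrict (inv_into (carrier S) f) (carrier S)"
    using auto_union_anti_auto_subset by (auto simp: inv_BijGroup)
  then show "inv\<^bsub>BijGroup (carrier S)\<^esub> f \<in> auto S \<union> anti_auto S"
    using f inv_auto inv_anti_auto by auto
qed (use auto_union_anti_auto_subset id_in_auto in \<open>auto simp: BijGroup_def\<close>)

lemma group_AutPMGroup: "group (AutPMGroup S)"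
  unfolding AutPMGroup_def
  using subgroup_auto_union_anti_auto group_BijGroup by (rule subgroup.subgroup_is_group)

lemma carrier_AutPMGroup: "carrier (AutPMGroup S) = auto S \<union> anti_auto S"
  by (simp add: AutPMGroup_def)

text \<open>The multiplication of \<open>BijGroup\<close> is itself restricted to bijections, so it
  unfolds to \<open>compose\<close> only for members.\<close>

lemma mult_AutPMGroup:
  "\<lbrakk>f \<in> carrier (AutPMGroup S); g \<in> carrier (AutPMGroup S)\<rbrakk>
    \<Longrightarrow> f \<otimes>\<^bsub>AutPMGroup S\<^esub> g = compose (carrier S) f g"
  using auto_union_anti_auto_subset by (auto simp: AutPMGroup_def BijGroup_def)

lemma one_AutPMGroup: "\<one>\<^bsub>AutPMGroup S\<^esub> = (\<lambda>x\<in>carrier S. x)"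
  by (simp add: AutPMGroup_def BijGroup_def)

lemma subgroup_auto: "subgroup (auto S) (AutPMGroup S)"
  unfolding AutPMGroup_def
  by (intro group.subgroup_incl group_BijGroup subgroup_auto_BijGroup
      subgroup_auto_union_anti_auto) simp

lemma proper_involution_complement:
  assumes "proper_involution S \<iota>"
  shows "involution_complement (AutPMGroup S) (auto S) \<iota>"
proof -
  \<comment> \<open>Properness enters here: an anti-automorphism may also be a homomorphism, and
    then \<iota> would lie in \<open>auto S\<close>.\<close>
  have \<iota>: "\<iota> \<in> anti_auto S" "\<iota> \<notin> auto S" "compose (carrier S) \<iota> \<iota> = (\<lambda>x\<in>carrier S. x)"
    using assms by (auto simp: proper_involution_def involutions_def auto_def)
  then show ?thesis
    unfolding involution_complement_def involution_complement_axioms_def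
    using group_AutPMGroup subgroup_auto
    by (auto simp: carrier_AutPMGroup mult_AutPMGroup one_AutPMGroup compose_anti_auto_anti_auto)
qed

lemma subgroup_involution_closure: "subgroup (involution_closure S) (AutPMGroup S)"
  unfolding involution_closure_def
  by (intro group.generate_is_subgroup group_AutPMGroup)
    (auto simp: carrier_AutPMGroup involutions_def)

end

theorem proposition3p2:
  fixes S :: "('a, 'b) monoid_scheme" and \<iota> :: "'a \<Rightarrow> 'a"
  assumes "carrier_semigroup S"
    and "proper_involution S \<iota>"
  shows "internal_semidirect (AutPMGroup S) (auto S) (generate (AutPMGroup S) {\<iota>})
    \<and> internal_semidirect (InvolutionGroup S) (involution_closure S \<inter> auto S)
        (generate (AutPMGroup S) {\<iota>})
    \<and> split_extension (AutPMGroup S) (auto S) (integer_mod_group 2)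
    \<and> split_extension (InvolutionGroup S) (involution_closure S \<inter> auto S) (integer_mod_group 2)"
proof -
  interpret carrier_semigroup S by (fact assms(1))
  interpret A: involution_complement "AutPMGroup S" "auto S" \<iota>
    using assms(2) by (rule proper_involution_complement)
  have \<iota>: "\<iota> \<in> involution_closure S"
    using assms(2) by (auto simp: proper_involution_def involution_closure_def intro: generate.incl)
  interpret C: involution_complement "InvolutionGroup S" "involution_closure S \<inter> auto S" \<iota>
    unfolding InvolutionGroup_def
    using subgroup_involution_closure \<iota> by (rule A.restrict_subgroup)
  \<comment> \<open>The instance \<open>C\<close> generates inside the subgroup, the claim inside
    \<open>AutPMGroup S\<close>; the results agree because the subgroup contains \<iota>.\<close>
  have "generate (InvolutionGroup S) {\<iota>} = generate (AutPMGroup S) {\<iota>}"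
    unfolding InvolutionGroup_def
    using \<iota> subgroup_involution_closure by (intro A.generate_consistent) auto
  then show ?thesis
    using A.internal_semidirect A.split_extension C.internal_semidirect C.split_extension by simp
qed

end
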